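(* Let $X=(X_t)_{t\ge0}$ be a real-valued Lévy process such that the distribution of $X_1$ has no atoms, and define the Lévy bridge $\mathring X_t=X_t-tX_1$, $t\in[0,1]$. Then $\mathring A=\int_0^1\mathbf 1\{\mathring X_t>0\}\,dt$ is uniformly distributed on $(0,1)$.
   Context: A Lévy process is a càdlàg process with $X_0=0$ and stationary independent increments. *)

theory Defs
  imports "HOL-Probability.Probability"
begin

definition cadlag_on_nonneg :: "(real \<Rightarrow> real) \<Rightarrow> bool" where
  "cadlag_on_nonneg f \<longleftrightarrow>
     (\<forall>t\<ge>0. continuous (at_right t) f) \<and>
     (\<forall>t>0. \<exists>l. (f \<longlongrightarrow> l) (at_left t))"

definition levy_process :: "'a measure \<Rightarrow> (real \<Rightarrow> 'a \<Rightarrow> real) \<Rightarrow> bool" where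
  "levy_process M X \<longleftrightarrow>
     prob_space M \<and>
     (\<forall>t\<ge>0. X t \<in> borel_measurable M) \<and>
     (\<forall>\<omega>\<in>space M. X 0 \<omega> = 0) \<and>
     (\<forall>\<omega>\<in>space M. cadlag_on_nonneg (\<lambda>t. X t \<omega>)) \<and>
     (\<forall>(n::nat) (s::nat \<Rightarrow> real). 0 \<le> s 0 \<and> (\<forall>i<n. s i < s (Suc i)) \<longrightarrow>
        prob_space.indep_vars M (\<lambda>_. borel) (\<lambda>i \<omega>. X (s (Suc i)) \<omega> - X (s i) \<omega>) {..<n}) \<and>
     (\<forall>s\<ge>0. \<forall>t\<ge>0. distr M borel (\<lambda>\<omega>. X (s + t) \<omega> - X s \<omega>) = distr M borel (X t))"

end

theory Submission
  imports Defs
begin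

text \<open>On the grid of mesh 1/n the bridge is a centred random walk with i.i.d. increments. Cyclically
  shifting the increments by j preserves their law and turns the number of grid points where the
  bridge is positive into the number of grid points where it exceeds its value at j/n. Almost surely
  the grid values are distinct, because an atomless X 1 forces every X h with h > 0 to be atomless;
  hence these numbers, as j varies, are a permutation of 0, ..., n - 1, and the discrete occupation
  time is exactly uniform on {0, 1/n, ..., (n - 1)/n}. It converges almost surely to the continuous
  one, as the paths are right-continuous and almost surely nonzero at almost every time.\<close>

section \<open>Cyclic shifts of centred partial sums\<close>

text \<open>Passing to a larger value strictly shrinks the set of points above, so ranks separate
  points. No point lies above itself, so ranks stay below \<open>card S\<close>, and equality of
  finite cardinalities gives surjectivity.\<close>

lemma bij_betw_rank:
  fixes f :: "'b \<Rightarrow> 'c::linorder"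
  assumes S: "finite S" and f: "inj_on f S"
  shows "bij_betw (\<lambda>i. card {l\<in>S. f i < f l}) S {..<card S}"
proof -
  let ?r = "\<lambda>i. card {l\<in>S. f i < f l}"
  have less: "?r j < ?r i" if "i \<in> S" "j \<in> S" "f i < f j" for i j
    using that S by (intro psubset_card_mono) (auto dest: less_trans)
  have inj: "inj_on ?r S"
  proof (rule inj_onI)
    fix i j assume ij: "i \<in> S" "j \<in> S" "?r i = ?r j"
    then have "f i = f j"
      using less[of i j] less[of j i] by (metis less_irrefl linorder_less_linear)
    with f ij show "i = j" by (auto dest: inj_onD)
  qed
  have "?r i < card S" if "i \<in> S" for i
    using that S by (intro psubset_card_mono) auto
  then have "?r ` S \<subseteq> {..<card S}" by auto
  moreover have "card (?r ` S) = card {..<card S}"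
    using card_image[OF inj] by simp
  ultimately have "?r ` S = {..<card S}" by (intro card_subset_eq) auto
  with inj show ?thesis by (simp add: bij_betw_def)
qed

lemma bij_betw_add_mod:
  fixes n j :: nat
  assumes "n > 0"
  shows "bij_betw (\<lambda>i. (i + j) mod n) {..<n} {..<n}"
proof -
  have "inj_on (\<lambda>i. (i + j) mod n) {..<n}"
  proof (rule linorder_inj_onI)
    fix a b assume ab: "a < b" "a \<in> {..<n}" "b \<in> {..<n}"
    then have "\<not> n dvd (b + j) - (a + j)" by (auto dest: dvd_imp_le)
    with ab show "(a + j) mod n \<noteq> (b + j) mod n"
      using mod_eq_dvd_iff_nat[of "a + j" "b + j" n] by auto
  qed auto
  moreover have "(\<lambda>i. (i + j) mod n) ` {..<n} \<subseteq> {..<n}" using assms by auto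
  ultimately show ?thesis
    by (simp add: bij_betw_def endo_inj_surj)
qed

text \<open>The discrete bridge of the walk with steps \<open>x\<close>: each step is centred by the
  mean of the \<open>n\<close> steps, so for positive \<open>n\<close> the walk returns to 0 at
  \<open>n\<close>.\<close>

definition psum :: "nat \<Rightarrow> (nat \<Rightarrow> real) \<Rightarrow> nat \<Rightarrow> real" where
  "psum n x i = (\<Sum>l<i. x l) - real i / real n * (\<Sum>l<n. x l)"

definition count_above :: "nat \<Rightarrow> (nat \<Rightarrow> real) \<Rightarrow> real" where
  "count_above n x = (\<Sum>i<n. if psum n x i > 0 then 1 else 0)"

lemma psum_cong: "(\<And>l. l < n \<Longrightarrow> x l = y l) \<Longrightarrow> i \<le> n \<Longrightarrow> psum n x i = psum n y i"
  unfolding psum_def by (intro arg_cong2[where f="(-)"] arg_cong2[where f="(*)"] sum.cong) auto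

lemma above_cong: "(\<And>l. l < n \<Longrightarrow> x l = y l) \<Longrightarrow> count_above n x = count_above n y"
  unfolding count_above_def by (intro sum.cong refl) (auto simp: psum_cong[of n x y])

text \<open>The centred steps sum to zero over one period, so the walk of their periodic extension
  is itself periodic. Rotating the steps by \<open>j\<close> restarts this walk at \<open>j\<close>,
  which subtracts its value there.\<close>

lemma psum_shift:
  assumes n: "n > 0" and j: "j < n" and i: "i \<le> n"
  shows "psum n (\<lambda>l. x ((l + j) mod n)) i = psum n x ((i + j) mod n) - psum n x j"
proof -
  define m where "m = (\<Sum>l<n. x l) / n"
  \<comment> \<open>\<open>T\<close> is the walk of the \<open>n\<close>-periodically extended
    centred steps; up to index \<open>n\<close> it coincides with \<open>psum n x\<close>.\<close>
  define T where "T k = (\<Sum>l<k. x (l mod n) - m)" for k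
  have per1: "T (k + n) = T k" for k
  proof (induction k)
    case 0
    have "T n = (\<Sum>l<n. x l - m)" unfolding T_def by (intro sum.cong) auto
    also have "\<dots> = 0" using n by (simp add: sum_subtractf m_def)
    finally show ?case by (simp add: T_def)
  qed (simp add: T_def)
  have per: "T (k + q * n) = T k" for k q
  proof (induction q)
    case (Suc q)
    then show ?case using per1[of "k + q * n"] by (simp add: algebra_simps)
  qed simp
  have T_mod: "T (k mod n) = T k" for k
    using per[of "k mod n" "k div n"] by simp
  have T_shift: "(\<Sum>l<k. x ((l + j) mod n) - m) = T (k + j) - T j" for k
    by (induction k) (simp_all add: T_def)
  have psum_T: "psum n x k = T k" if "k \<le> n" for k
  proof -
    have "T k = (\<Sum>l<k. x l - m)" unfolding T_def using that by (intro sum.cong) auto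
    then show ?thesis by (simp add: psum_def m_def sum_subtractf)
  qed
  \<comment> \<open>The rotation permutes the steps, so the rotated sequence is centred by the same
    mean \<open>m\<close>.\<close>
  have total: "(\<Sum>l<n. x ((l + j) mod n)) = (\<Sum>l<n. x l)"
    using sum.reindex_bij_betw[OF bij_betw_add_mod[OF n, of j], of x] by simp
  have "psum n (\<lambda>l. x ((l + j) mod n)) i = (\<Sum>l<i. x ((l + j) mod n) - m)"
    by (simp add: psum_def total m_def sum_subtractf)
  also have "\<dots> = T ((i + j) mod n) - T j" by (simp add: T_shift T_mod)
  finally show ?thesis using n j by (simp add: psum_T)
qed

text \<open>By \<open>psum_shift\<close> the rotated bridge is positive at \<open>i\<close> exactly
  when the original one at \<open>(i + j) mod n\<close> exceeds its value at \<open>j\<close>.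
  Counting over all \<open>i\<close> therefore gives the rank of index \<open>j\<close> from the
  top.\<close>

lemma above_shift:
  assumes n: "n > 0" and j: "j < n"
  shows "count_above n (\<lambda>l. x ((l + j) mod n)) = card {i\<in>{..<n}. psum n x j < psum n x i}"
proof -
  have "count_above n (\<lambda>l. x ((l + j) mod n))
      = (\<Sum>i<n. if psum n x j < psum n x ((i + j) mod n) then 1 else 0)"
    unfolding count_above_def using n j by (intro sum.cong) (auto simp: psum_shift)
  also have "\<dots> = (\<Sum>i<n. if psum n x j < psum n x i then 1 else 0)"
    using sum.reindex_bij_betw[OF bij_betw_add_mod[OF n, of j],
        of "\<lambda>i. if psum n x j < psum n x i then 1 else (0::real)"] by simp
  also have "\<dots> = card {i\<in>{..<n}. psum n x j < psum n x i}"
    by (simp add: sum.If_cases Int_def)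
  finally show ?thesis .
qed

text \<open>The deterministic core: without ties the ranks of the \<open>n\<close> starting points
  are a permutation of \<open>0, ..., n - 1\<close>, so the sum over all rotations no longer depends
  on \<open>x\<close>.\<close>

lemma sum_above_shifts:
  fixes F :: "real \<Rightarrow> 'b::comm_monoid_add"
  assumes n: "n > 0" and inj: "inj_on (psum n x) {..<n}"
  shows "(\<Sum>j<n. F (count_above n (\<lambda>l. x ((l + j) mod n)))) = (\<Sum>k<n. F (real k))"
proof -
  have "(\<Sum>j<n. F (count_above n (\<lambda>l. x ((l + j) mod n))))
      = (\<Sum>j<n. F (real (card {i\<in>{..<n}. psum n x j < psum n x i})))"
    using n by (intro sum.cong) (auto simp: above_shift)
  also have "\<dots> = (\<Sum>k<n. F (real k))"
    using sum.reindex_bij_betw[OF bij_betw_rank[OF _ inj], of "\<lambda>k. F (real k)"] by simp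
  finally show ?thesis .
qed

lemma measurable_psum:
  "i \<le> n \<Longrightarrow> (\<lambda>x. psum n x i) \<in> borel_measurable (PiM {..<n} (\<lambda>_. borel))"
  unfolding psum_def
  by (intro borel_measurable_diff borel_measurable_times borel_measurable_sum
      borel_measurable_const measurable_component_singleton) auto

lemma measurable_above: "count_above n \<in> borel_measurable (PiM {..<n} (\<lambda>_. borel))"
proof -
  have [measurable]: "(\<lambda>x. psum n x i) \<in> borel_measurable (PiM {..<n} (\<lambda>_. borel))"
    if "i \<in> {..<n}" for i
    using that by (intro measurable_psum) auto
  show ?thesis unfolding count_above_def[abs_def] by measurable
qed

section \<open>Averages over the unit interval\<close>

abbreviation unif :: "real measure" where
  "unif \<equiv> uniform_measure lborel {0<..<1}"

lemma prob_space_unif: "prob_space unif"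
  by (intro prob_space_uniform_measure) auto

lemma AE_unif: "AE t in unif. t \<in> {0<..<1}"
  by (rule AE_uniform_measureI) auto

text \<open>Within the unit interval the cell lies between an open and a closed interval with the
  same endpoints, both of length \<open>1 / n\<close>.\<close>

lemma measure_floor_unif:
  assumes n: "n > 0" and i: "i < n"
  shows "measure unif {t. nat \<lfloor>real n * t\<rfloor> = i} = 1 / n"
proof -
  interpret prob_space unif by (rule prob_space_unif)
  \<comment> \<open>For \<open>i = 0\<close> the function \<open>nat\<close> also sends every
    negative floor to 0, so the second inclusion is restricted to the unit interval.\<close>
  have floor: "t \<in> {real i / n <..< real (Suc i) / n} \<Longrightarrow> nat \<lfloor>real n * t\<rfloor> = i"
    "t \<in> {0<..<1} \<Longrightarrow> nat \<lfloor>real n * t\<rfloor> = i \<Longrightarrow> t \<in> {real i / n .. real (Suc i) / n}" for t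
  proof -
    assume "t \<in> {real i / n <..< real (Suc i) / n}"
    then have "real i < real n * t" "real n * t < real i + 1"
      using n by (auto simp: field_simps)
    then have "\<lfloor>real n * t\<rfloor> = int i" by (intro floor_unique) auto
    then show "nat \<lfloor>real n * t\<rfloor> = i" by simp
  next
    assume t: "t \<in> {0<..<1}" "nat \<lfloor>real n * t\<rfloor> = i"
    then have "\<lfloor>real n * t\<rfloor> = int i" using n by (auto simp: nat_eq_iff)
    then have "real i \<le> real n * t" "real n * t < real i + 1" by linarith+
    then show "t \<in> {real i / n .. real (Suc i) / n}" using n by (auto simp: field_simps)
  qed
  have le: "real (Suc i) / n \<le> 1" using i n by (simp add: field_simps)
  have "emeasure unif {t. nat \<lfloor>real n * t\<rfloor> = i}
      = emeasure lborel ({0<..<1} \<inter> {t. nat \<lfloor>real n * t\<rfloor> = i})"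
    by (subst emeasure_uniform_measure) (auto simp: divide_ennreal_def)
  also have "\<dots> = ennreal (1 / n)"
  proof (rule antisym)
    have "emeasure lborel ({0<..<1} \<inter> {t. nat \<lfloor>real n * t\<rfloor> = i})
        \<le> emeasure lborel {real i / n .. real (Suc i) / n}"
      using floor(2) by (intro emeasure_mono) auto
    also have "\<dots> = ennreal (1 / n)"
      using n by (subst emeasure_lborel_Icc) (auto simp: field_simps)
    finally show "emeasure lborel ({0<..<1} \<inter> {t. nat \<lfloor>real n * t\<rfloor> = i}) \<le> ennreal (1 / n)" .
    have "t \<in> {0<..<1}" if "t \<in> {real i / n <..< real (Suc i) / n}" for t
    proof -
      have "0 \<le> real i / n" by simp
      moreover from that have "real i / n < t" "t < real (Suc i) / n" by auto
      ultimately have "0 < t" "t < 1" using le by linarith+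
      then show ?thesis by simp
    qed
    then have "emeasure lborel {real i / n <..< real (Suc i) / n}
        \<le> emeasure lborel ({0<..<1} \<inter> {t. nat \<lfloor>real n * t\<rfloor> = i})"
      using floor(1) by (intro emeasure_mono) auto
    moreover have "emeasure lborel {real i / n <..< real (Suc i) / n} = ennreal (1 / n)"
      using n by (subst emeasure_lborel_Ioo) (auto simp: field_simps)
    ultimately show "ennreal (1 / n) \<le> emeasure lborel ({0<..<1} \<inter> {t. nat \<lfloor>real n * t\<rfloor> = i})"
      by simp
  qed
  finally show ?thesis by (simp add: measure_def)
qed

text \<open>Writes an average over grid indices as an integral over a fixed probability space, so
  that dominated convergence applies as the mesh shrinks. The values are real for occupation counts
  and complex for characteristic functions.\<close>

lemma integral_floor_unif:
  fixes h :: "nat \<Rightarrow> 'b::{banach, second_countable_topology}"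
  assumes n: "n > 0"
  shows "(\<integral>t. h (nat \<lfloor>real n * t\<rfloor>) \<partial>unif) = (1 / n) *\<^sub>R (\<Sum>i<n. h i)"
proof -
  interpret prob_space unif by (rule prob_space_unif)
  let ?S = "\<lambda>i. {t. nat \<lfloor>real n * t\<rfloor> = i}"
  have [measurable]: "?S i \<in> sets borel" for i by measurable
  have "(\<integral>t. h (nat \<lfloor>real n * t\<rfloor>) \<partial>unif) = (\<integral>t. (\<Sum>i<n. indicator (?S i) t *\<^sub>R h i) \<partial>unif)"
  proof (rule integral_cong_AE)
    show "(\<lambda>t. h (nat \<lfloor>real n * t\<rfloor>)) \<in> borel_measurable unif"
      by (rule measurable_compose[where N="count_space UNIV"]) auto
    show "AE t in unif. h (nat \<lfloor>real n * t\<rfloor>) = (\<Sum>i<n. indicator (?S i) t *\<^sub>R h i)"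
      using AE_unif
    proof eventually_elim
      case (elim t)
      then have "real n * t < real n" using n by auto
      then have "\<lfloor>real n * t\<rfloor> < int n" by linarith
      then have "nat \<lfloor>real n * t\<rfloor> < n" using n by linarith
      then have "nat \<lfloor>real n * t\<rfloor> \<in> {..<n}" by simp
      then show ?case
        using sum.delta'[of "{..<n}" "nat \<lfloor>real n * t\<rfloor>" h]
        by (simp add: indicator_def of_bool_def if_distrib[of "\<lambda>c. c *\<^sub>R _"] cong: if_cong)
    qed
  qed measurable
  also have "\<dots> = (\<Sum>i<n. \<integral>t. indicator (?S i) t *\<^sub>R h i \<partial>unif)"
    by (intro Bochner_Integration.integral_sum integrable_scaleR_left integrable_real_indicator)
       (auto simp: less_top[symmetric] simp del: emeasure_uniform_measure)
  also have "\<dots> = (\<Sum>i<n. measure unif (?S i) *\<^sub>R h i)"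
  proof (intro sum.cong refl)
    fix i
    have "integrable unif (indicator (?S i) :: real \<Rightarrow> real)"
      by (intro integrable_real_indicator)
         (auto simp: less_top[symmetric] simp del: emeasure_uniform_measure)
    then show "(\<integral>t. indicator (?S i) t *\<^sub>R h i \<partial>unif) = measure unif (?S i) *\<^sub>R h i"
      by (simp add: integral_scaleR_left del: measure_uniform_measure)
  qed
  also have "\<dots> = (1 / n) *\<^sub>R (\<Sum>i<n. h i)"
    using n by (simp add: measure_floor_unif scaleR_sum_right del: measure_uniform_measure)
  finally show ?thesis .
qed

text \<open>The left grid neighbour of \<open>t\<close> suffices for continuous test functions. The
  right neighbour stays strictly above \<open>t\<close>, even if \<open>t\<close> is a grid point,
  which is the form of convergence that right-continuous paths require.\<close>

lemma floor_grid_tendsto: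
  assumes t: "0 \<le> (t::real)"
  shows "(\<lambda>n. real (nat \<lfloor>real (Suc n) * t\<rfloor>) / real (Suc n)) \<longlonglongrightarrow> t"
    and "filterlim (\<lambda>n. real (Suc (nat \<lfloor>real (Suc n) * t\<rfloor>)) / real (Suc n)) (at_right t) sequentially"
proof -
  let ?r = "\<lambda>n. real (nat \<lfloor>real (Suc n) * t\<rfloor>)"
  have r: "?r n \<le> real (Suc n) * t" "real (Suc n) * t < ?r n + 1" for n
    using t by (auto simp del: of_nat_Suc)
  have bounds: "t - 1 / N \<le> a / N \<and> a / N \<le> t \<and> t < (a + 1) / N \<and> (a + 1) / N \<le> t + 1 / N"
    if "a \<le> N * t" "N * t < a + 1" "N > 0" for a N :: real
  proof -
    have "a / N \<le> t" "t < (a + 1) / N"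
      using that by (simp_all add: pos_divide_le_eq pos_less_divide_eq mult.commute)
    then show ?thesis by (simp add: add_divide_distrib)
  qed
  have b: "t - 1 / real (Suc n) \<le> ?r n / real (Suc n)" "?r n / real (Suc n) \<le> t"
    "t < (?r n + 1) / real (Suc n)" "(?r n + 1) / real (Suc n) \<le> t + 1 / real (Suc n)" for n
    using bounds[OF r[of n]] by auto
  have lims: "(\<lambda>n. t - 1 / real (Suc n)) \<longlonglongrightarrow> t - 0" "(\<lambda>n. t + 1 / real (Suc n)) \<longlonglongrightarrow> t + 0"
    by (intro tendsto_intros LIMSEQ_inverse_real_of_nat[unfolded inverse_eq_divide])+
  show "(\<lambda>n. ?r n / real (Suc n)) \<longlonglongrightarrow> t"
    by (rule tendsto_sandwich[OF _ _ lims(1)[unfolded diff_0_right] tendsto_const])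
      (use b in \<open>auto simp del: of_nat_Suc\<close>)
  have "(\<lambda>n. (?r n + 1) / real (Suc n)) \<longlonglongrightarrow> t"
    by (rule tendsto_sandwich[OF _ _ tendsto_const lims(2)[unfolded add_0_right]])
      (use b in \<open>auto intro!: always_eventually less_imp_le simp del: of_nat_Suc\<close>)
  moreover have "eventually (\<lambda>n. (?r n + 1) / real (Suc n) \<in> {t<..} \<and> (?r n + 1) / real (Suc n) \<noteq> t) sequentially"
    using b(3) by (intro always_eventually allI) (metis greaterThan_iff less_irrefl)
  ultimately show "filterlim (\<lambda>n. real (Suc (nat \<lfloor>real (Suc n) * t\<rfloor>)) / real (Suc n)) (at_right t) sequentially"
    by (simp add: filterlim_at add.commute)
qed

text \<open>The Riemann sum is the integral of \<open>F\<close> at the left grid neighbour of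
  \<open>t\<close>, which converges boundedly to \<open>F t\<close>.\<close>

lemma riemann_sum_tendsto_unif:
  fixes F :: "real \<Rightarrow> 'b::{banach, second_countable_topology}"
  assumes F: "continuous_on UNIV F" and bd: "\<And>x. norm (F x) \<le> K"
  shows "(\<lambda>n. (1 / Suc n) *\<^sub>R (\<Sum>k<Suc n. F (real k / Suc n))) \<longlonglongrightarrow> (\<integral>t. F t \<partial>unif)"
proof -
  interpret prob_space unif by (rule prob_space_unif)
  have [measurable]: "F \<in> borel_measurable borel"
    by (rule borel_measurable_continuous_onI[OF F])
  have "(\<lambda>n. \<integral>t. F (real (nat \<lfloor>real (Suc n) * t\<rfloor>) / Suc n) \<partial>unif) \<longlonglongrightarrow> (\<integral>t. F t \<partial>unif)"
  proof (rule integral_dominated_convergence[where w="\<lambda>_. K"])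
    show "AE t in unif. (\<lambda>n. F (real (nat \<lfloor>real (Suc n) * t\<rfloor>) / Suc n)) \<longlonglongrightarrow> F t"
      using AE_unif
    proof eventually_elim
      case (elim t)
      then show ?case
        using F floor_grid_tendsto(1)[of t]
        by (intro isCont_tendsto_compose[of t F])
           (auto simp: continuous_on_eq_continuous_at simp del: of_nat_Suc)
    qed
  qed (use bd in auto)
  moreover have "(\<integral>t. F (real (nat \<lfloor>real (Suc n) * t\<rfloor>) / Suc n) \<partial>unif)
      = (1 / Suc n) *\<^sub>R (\<Sum>k<Suc n. F (real k / Suc n))" for n
    by (rule integral_floor_unif[where h="\<lambda>k. F (real k / Suc n)"]) simp
  ultimately show ?thesis by simp
qed

section \<open>Independence and atoms\<close>

text \<open>Fubini for the product law: once the value \<open>z\<close> of \<open>Z\<close> is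
  frozen, the atomless law of \<open>Y\<close> does not charge the single point
  \<open>f z\<close>.\<close>

lemma (in prob_space) indep_var_AE_neq:
  fixes Y Z :: "'a \<Rightarrow> real"
  assumes ind: "indep_var borel Y borel Z"
    and Y: "\<And>x. AE \<omega> in M. Y \<omega> \<noteq> x"
    and [measurable]: "f \<in> borel_measurable borel"
  shows "AE \<omega> in M. Y \<omega> \<noteq> f (Z \<omega>)"
proof -
  from ind have [measurable]: "random_variable borel Y" "random_variable borel Z"
    and joint: "distr M borel Y \<Otimes>\<^sub>M distr M borel Z = distr M (borel \<Otimes>\<^sub>M borel) (\<lambda>x. (Y x, Z x))"
    by (auto simp: indep_var_distribution_eq)
  interpret Y: prob_space "distr M borel Y" by (rule prob_space_distr) measurable
  interpret Z: prob_space "distr M borel Z" by (rule prob_space_distr) measurable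
  interpret P: pair_sigma_finite "distr M borel Y" "distr M borel Z" ..
  have S: "{x \<in> space (distr M borel Y \<Otimes>\<^sub>M distr M borel Z). fst x \<noteq> f (snd x)}
      \<in> sets (distr M borel Y \<Otimes>\<^sub>M distr M borel Z)"
    by measurable
  have "AE z in distr M borel Z. AE y in distr M borel Y. y \<noteq> f z"
    by (rule AE_I2, subst AE_distr_iff) (use Y in auto)
  then have "AE p in distr M borel Y \<Otimes>\<^sub>M distr M borel Z. fst p \<noteq> f (snd p)"
    using P.AE_commute[of "\<lambda>y z. y \<noteq> f z"] P.AE_pair_iff[of "\<lambda>y z. y \<noteq> f z"] S by simp
  then show ?thesis
    unfolding joint by (subst (asm) AE_distr_iff) auto
qed

locale atomless_levy =
  fixes M :: "'a measure" and X :: "real \<Rightarrow> 'a \<Rightarrow> real"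
  assumes levy: "levy_process M X"
    and atomless: "measure M {\<omega>\<in>space M. X 1 \<omega> = x} = 0"

sublocale atomless_levy \<subseteq> prob_space M
  using levy by (simp add: levy_process_def)

context atomless_levy
begin

lemma X_measurable: "t \<ge> 0 \<Longrightarrow> X t \<in> borel_measurable M"
  and X_0: "\<omega> \<in> space M \<Longrightarrow> X 0 \<omega> = 0"
  and X_cadlag: "\<omega> \<in> space M \<Longrightarrow> cadlag_on_nonneg (\<lambda>t. X t \<omega>)"
  and X_indep: "0 \<le> s 0 \<Longrightarrow> (\<And>i. i < n \<Longrightarrow> s i < s (Suc i)) \<Longrightarrow>
        indep_vars (\<lambda>_. borel) (\<lambda>i \<omega>. X (s (Suc i)) \<omega> - X (s i) \<omega>) {..<n}"
  and X_stat: "u \<ge> 0 \<Longrightarrow> t \<ge> 0 \<Longrightarrow>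
        distr M borel (\<lambda>\<omega>. X (u + t) \<omega> - X u \<omega>) = distr M borel (X t)"
  using levy unfolding levy_process_def by blast+

lemma AE_X_1_neq: "AE \<omega> in M. X 1 \<omega> \<noteq> x"
proof -
  have [measurable]: "X 1 \<in> borel_measurable M" by (rule X_measurable) simp
  have "{\<omega>\<in>space M. X 1 \<omega> = x} \<in> null_sets M"
    using atomless[of x] by (intro null_setsI) (auto simp: emeasure_eq_measure)
  then show ?thesis by (rule AE_I') auto
qed

lemma indep_increment:
  assumes s: "0 < s" and t: "s < t"
  shows "indep_var borel (X s) borel (\<lambda>\<omega>. X t \<omega> - X s \<omega>)"
proof -
  \<comment> \<open>The partition 0, \<open>s\<close>, \<open>t\<close>, whose two increments are
    the variables in question.\<close>
  define p where "p i = (if i = 0 then 0 else if i = 1 then s else t)" for i :: nat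
  let ?Y = "\<lambda>i \<omega>. X (p (Suc i)) \<omega> - X (p i) \<omega>"
  have "indep_vars (\<lambda>_. borel) ?Y {..<2}"
    using s t by (intro X_indep) (auto simp: p_def less_2_cases_iff)
  then have "indep_var (PiM {0} (\<lambda>_. borel)) (\<lambda>\<omega>. restrict (\<lambda>i. ?Y i \<omega>) {0})
      (PiM {1} (\<lambda>_. borel)) (\<lambda>\<omega>. restrict (\<lambda>i. ?Y i \<omega>) {1})"
    by (rule indep_var_restrict) auto
  then have "indep_var borel ((\<lambda>f. f 0) \<circ> (\<lambda>\<omega>. restrict (\<lambda>i. ?Y i \<omega>) {0}))
      borel ((\<lambda>f. f 1) \<circ> (\<lambda>\<omega>. restrict (\<lambda>i. ?Y i \<omega>) {1}))"
    by (rule indep_var_compose) (auto intro: measurable_component_singleton)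
  then have "indep_var borel (\<lambda>\<omega>. X s \<omega> - X 0 \<omega>) borel (\<lambda>\<omega>. X t \<omega> - X s \<omega>)"
    by (simp add: p_def comp_def)
  \<comment> \<open>\<open>X 0\<close> vanishes only on \<open>space M\<close>, so the two variables
    need not be equal as functions; independence is transferred through their laws instead.\<close>
  moreover have "indep_var borel (\<lambda>\<omega>. X s \<omega> - X 0 \<omega>) borel (\<lambda>\<omega>. X t \<omega> - X s \<omega>) \<longleftrightarrow>
      indep_var borel (X s) borel (\<lambda>\<omega>. X t \<omega> - X s \<omega>)"
  proof -
    have "distr M borel (\<lambda>\<omega>. X s \<omega> - X 0 \<omega>) = distr M borel (X s)"
      by (rule distr_cong) (auto simp: X_0)
    moreover have "distr M (borel \<Otimes>\<^sub>M borel) (\<lambda>\<omega>. (X s \<omega> - X 0 \<omega>, X t \<omega> - X s \<omega>))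
        = distr M (borel \<Otimes>\<^sub>M borel) (\<lambda>\<omega>. (X s \<omega>, X t \<omega> - X s \<omega>))"
      by (rule distr_cong) (auto simp: X_0)
    moreover have "(\<lambda>\<omega>. X s \<omega> - X 0 \<omega>) \<in> borel_measurable M" "X s \<in> borel_measurable M"
      using s by (auto intro!: borel_measurable_diff X_measurable)
    ultimately show ?thesis by (simp add: indep_var_distribution_eq)
  qed
  ultimately show ?thesis by simp
qed

lemma measure_increment_eq:
  assumes "s \<ge> 0" "t \<ge> 0"
  shows "prob {\<omega>\<in>space M. X (s + t) \<omega> - X s \<omega> = x} = prob {\<omega>\<in>space M. X t \<omega> = x}"
proof -
  have [measurable]: "X (s + t) \<in> borel_measurable M" "X s \<in> borel_measurable M"
    "X t \<in> borel_measurable M" using assms by (auto intro: X_measurable)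
  have "measure (distr M borel (\<lambda>\<omega>. X (s + t) \<omega> - X s \<omega>)) {x} = measure (distr M borel (X t)) {x}"
    using X_stat[OF assms] by simp
  then show ?thesis
    by (simp add: measure_distr vimage_def Int_def conj_commute)
qed

text \<open>Induction on the number of increments: being at the multiple of \<open>a\<close> and
  then gaining exactly \<open>a\<close> over the next stretch of length \<open>h\<close> are
  independent events of positive probability.\<close>

lemma atom_multiples:
  assumes h: "h > 0" and p: "prob {\<omega>\<in>space M. X h \<omega> = a} > 0"
  shows "prob {\<omega>\<in>space M. X (real (Suc n) * h) \<omega> = real (Suc n) * a} > 0"
proof (induction n)
  case 0
  show ?case using p by simp
next
  case (Suc n)
  let ?s = "real (Suc n) * h"
  have s: "?s > 0" using h by simp
  have e: "real (Suc (Suc n)) * h = ?s + h" by (simp add: algebra_simps)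
  have [measurable]: "X ?s \<in> borel_measurable M" "X (?s + h) \<in> borel_measurable M"
    using s h by (auto intro!: X_measurable)
  have "indep_var borel (X ?s) borel (\<lambda>\<omega>. X (?s + h) \<omega> - X ?s \<omega>)"
    using s h by (intro indep_increment) auto
  from indep_varD[OF this, of "{real (Suc n) * a}" "{a}"]
  have "prob {\<omega>\<in>space M. X ?s \<omega> = real (Suc n) * a \<and> X (?s + h) \<omega> - X ?s \<omega> = a}
      = prob {\<omega>\<in>space M. X ?s \<omega> = real (Suc n) * a} * prob {\<omega>\<in>space M. X h \<omega> = a}"
    using measure_increment_eq[of ?s h a] s h
    by (simp add: vimage_def Int_def conj_commute del: of_nat_Suc)
  then have "0 < prob {\<omega>\<in>space M. X ?s \<omega> = real (Suc n) * a \<and> X (?s + h) \<omega> - X ?s \<omega> = a}"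
    using Suc.IH p by simp
  also have "\<dots> \<le> prob {\<omega>\<in>space M. X (?s + h) \<omega> = real (Suc (Suc n)) * a}"
  proof (rule finite_measure_mono)
    show "{\<omega>\<in>space M. X (?s + h) \<omega> = real (Suc (Suc n)) * a} \<in> events" by measurable
  qed (auto simp: algebra_simps)
  finally show ?case unfolding e .
qed

text \<open>An atom at some time would propagate along the multiples of that time past time 1, where
  the independent atomless summand X 1 excludes it.\<close>

lemma AE_X_neq:
  assumes h: "h > 0"
  shows "AE \<omega> in M. X h \<omega> \<noteq> a"
proof -
  have [measurable]: "X h \<in> borel_measurable M" using h by (intro X_measurable) simp
  have "\<not> prob {\<omega>\<in>space M. X h \<omega> = a} > 0"
  proof
    assume p: "prob {\<omega>\<in>space M. X h \<omega> = a} > 0"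
    obtain n where "1 / h < real n" using reals_Archimedean2 by blast
    then have "1 < real n * h" using h by (simp add: field_simps)
    also have "\<dots> \<le> real (Suc n) * h" using h by simp
    finally have t: "1 < real (Suc n) * h" .
    let ?t = "real (Suc n) * h" and ?b = "real (Suc n) * a"
    have [measurable]: "X ?t \<in> borel_measurable M" using h by (intro X_measurable) simp
    have "AE \<omega> in M. X 1 \<omega> \<noteq> ?b - (X ?t \<omega> - X 1 \<omega>)"
      by (rule indep_var_AE_neq[where f="\<lambda>z. ?b - z", OF indep_increment[OF _ t] AE_X_1_neq]) auto
    then have "AE \<omega> in M. \<not> X ?t \<omega> = ?b" by eventually_elim auto
    then have "prob {\<omega>\<in>space M. X ?t \<omega> = ?b} = 0" by (intro prob_eq_0_AE) auto
    with atom_multiples[OF h p, of n] show False by simp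
  qed
  then have "prob {\<omega>\<in>space M. X h \<omega> = a} = 0"
    using zero_less_measure_iff by blast
  then show ?thesis by (subst (asm) prob_eq_0) auto
qed

text \<open>The bridge at \<open>t\<close> equals \<open>(1 - t) * X t - t * (X 1 - X t)\<close>. A
  zero would make the atomless \<open>X t\<close> a function of the independent increment
  \<open>X 1 - X t\<close>.\<close>

lemma AE_bridge_neq_0:
  assumes t: "0 < t" "t < 1"
  shows "AE \<omega> in M. X t \<omega> - t * X 1 \<omega> \<noteq> 0"
proof -
  have "AE \<omega> in M. X t \<omega> \<noteq> t / (1 - t) * (X 1 \<omega> - X t \<omega>)"
    using t by (intro indep_var_AE_neq[where f="\<lambda>z. t / (1 - t) * z", OF indep_increment AE_X_neq]) auto
  then show ?thesis
  proof eventually_elim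
    case (elim \<omega>)
    then show ?case using t by (auto simp: field_simps)
  qed
qed

section \<open>The bridge on a grid\<close>

definition incr :: "nat \<Rightarrow> 'a \<Rightarrow> nat \<Rightarrow> real" where
  "incr n \<omega> l = X (real (Suc l) / real n) \<omega> - X (real l / real n) \<omega>"

lemma incr_measurable: "(\<lambda>\<omega>. incr n \<omega> l) \<in> borel_measurable M"
  unfolding incr_def by (intro borel_measurable_diff X_measurable) auto

lemma psum_incr:
  assumes n: "n > 0" and \<omega>: "\<omega> \<in> space M"
  shows "psum n (incr n \<omega>) i = X (real i / n) \<omega> - real i / n * X 1 \<omega>"
proof -
  have "(\<Sum>l<k. incr n \<omega> l) = X (real k / n) \<omega>" for k
    unfolding incr_def using X_0[OF \<omega>] sum_lessThan_telescope[of "\<lambda>l. X (real l / n) \<omega>" k]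
    by (simp del: of_nat_Suc)
  then show ?thesis using n by (simp add: psum_def)
qed

text \<open>The increments over a grid of equal mesh are i.i.d., and a power of a single law is
  invariant under permuting coordinates. The right-hand side is free of \<open>j\<close>, so any two
  shifts can be exchanged inside a law.\<close>

lemma incr_distr_shift:
  assumes n: "n > 0"
  shows "distr M (PiM {..<n} (\<lambda>_. borel)) (\<lambda>\<omega>. \<lambda>l\<in>{..<n}. incr n \<omega> ((l + j) mod n))
       = PiM {..<n} (\<lambda>_. distr M borel (X (1 / n)))"
proof -
  let ?D = "distr M borel (X (1 / n))"
  let ?P = "PiM {..<n} (\<lambda>_. borel)"
  have [measurable]: "(\<lambda>\<omega>. incr n \<omega> l) \<in> borel_measurable M" for l by (rule incr_measurable)
  have D: "prob_space ?D" by (intro prob_space_distr X_measurable) auto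
  have "indep_vars (\<lambda>_. borel) (\<lambda>l \<omega>. incr n \<omega> l) {..<n}"
    unfolding incr_def using n by (intro X_indep[of "\<lambda>i. real i / real n"]) (auto simp: field_simps)
  then have "distr M ?P (\<lambda>\<omega>. \<lambda>l\<in>{..<n}. incr n \<omega> l)
      = PiM {..<n} (\<lambda>l. distr M borel (\<lambda>\<omega>. incr n \<omega> l))"
    using n by (subst (asm) indep_vars_iff_distr_eq_PiM') (auto intro: incr_measurable)
  also have "(\<lambda>l. distr M borel (\<lambda>\<omega>. incr n \<omega> l)) = (\<lambda>l. ?D)"
  proof
    fix l
    show "distr M borel (\<lambda>\<omega>. incr n \<omega> l) = ?D"
      using X_stat[of "real l / n" "1 / n"] unfolding incr_def
      by (simp add: add_divide_distrib add.commute)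
  qed
  finally have base: "distr M ?P (\<lambda>\<omega>. \<lambda>l\<in>{..<n}. incr n \<omega> l) = PiM {..<n} (\<lambda>_. ?D)" .
  have "distr M ?P (\<lambda>\<omega>. \<lambda>l\<in>{..<n}. incr n \<omega> ((l + j) mod n))
      = distr (distr M ?P (\<lambda>\<omega>. \<lambda>l\<in>{..<n}. incr n \<omega> l)) ?P (\<lambda>x. \<lambda>l\<in>{..<n}. x ((l + j) mod n))"
  proof (subst distr_distr)
    show "(\<lambda>x. \<lambda>l\<in>{..<n}. x ((l + j) mod n)) \<in> ?P \<rightarrow>\<^sub>M ?P"
      using n by (intro measurable_restrict measurable_component_singleton) auto
    show "(\<lambda>\<omega>. \<lambda>l\<in>{..<n}. incr n \<omega> l) \<in> M \<rightarrow>\<^sub>M ?P"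
      by (intro measurable_restrict) measurable
    show "distr M ?P (\<lambda>\<omega>. \<lambda>l\<in>{..<n}. incr n \<omega> ((l + j) mod n)) =
      distr M ?P ((\<lambda>x. \<lambda>l\<in>{..<n}. x ((l + j) mod n)) \<circ> (\<lambda>\<omega>. \<lambda>l\<in>{..<n}. incr n \<omega> l))"
      using n by (intro distr_cong) (auto simp: fun_eq_iff)
  qed
  \<comment> \<open>The target \<open>?P\<close> is replaced by the product of the
    \<open>?D\<close>, which has the same measurable sets, so that source and target agree for
    reindexing.\<close>
  also have "\<dots> = distr (PiM {..<n} (\<lambda>_. ?D)) (PiM {..<n} (\<lambda>_. ?D)) (\<lambda>x. \<lambda>l\<in>{..<n}. x ((l + j) mod n))"
    unfolding base by (intro distr_cong refl sets_PiM_cong) auto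
  also have "\<dots> = PiM {..<n} (\<lambda>_. ?D)"
    using n bij_betw_add_mod[OF n, of j]
    by (intro distr_PiM_reindex[where M="\<lambda>_. ?D"] D) (auto simp: bij_betw_def)
  finally show ?thesis .
qed

lemma incr_shift_measurable:
  "(\<lambda>\<omega>. \<lambda>l\<in>{..<n}. incr n \<omega> ((l + j) mod n)) \<in> M \<rightarrow>\<^sub>M PiM {..<n} (\<lambda>_. borel)"
  by (intro measurable_restrict incr_measurable)

text \<open>For \<open>i < j\<close> the difference of the values at \<open>j\<close> and
  \<open>i\<close> is the value at \<open>j - i\<close> of the bridge rotated by \<open>i\<close>.
  This has the law of the unrotated bridge at the time \<open>(j - i) / n\<close> in the open unit
  interval, where it is almost surely nonzero.\<close>

lemma AE_psum_inj:
  assumes n: "n > 0"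
  shows "AE \<omega> in M. inj_on (psum n (incr n \<omega>)) {..<n}"
proof -
  let ?P = "PiM {..<n} (\<lambda>_. borel) :: (nat \<Rightarrow> real) measure"
  let ?sh = "\<lambda>j \<omega>. \<lambda>l\<in>{..<n}. incr n \<omega> ((l + j) mod n)"
  have neq: "AE \<omega> in M. psum n (incr n \<omega>) i \<noteq> psum n (incr n \<omega>) j" if ij: "i < j" "j < n" for i j
  proof -
    let ?k = "j - i"
    have S: "{x\<in>space ?P. psum n x ?k \<noteq> 0} \<in> sets ?P"
    proof -
      have [measurable]: "(\<lambda>x. psum n x ?k) \<in> borel_measurable ?P"
        using ij by (intro measurable_psum) auto
      show ?thesis by measurable
    qed
    have "AE \<omega> in M. X (real ?k / n) \<omega> - real ?k / n * X 1 \<omega> \<noteq> 0"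
      using ij n by (intro AE_bridge_neq_0) (auto simp: field_simps)
    then have "AE \<omega> in M. psum n (?sh 0 \<omega>) ?k \<noteq> 0"
      using AE_space
    proof eventually_elim
      case (elim \<omega>)
      have "psum n (?sh 0 \<omega>) ?k = psum n (incr n \<omega>) ?k"
        using ij by (intro psum_cong) auto
      with elim psum_incr[OF n elim(2)] show ?case by simp
    qed
    then have "AE x in distr M ?P (?sh 0). psum n x ?k \<noteq> 0"
      using S by (subst AE_distr_iff[OF incr_shift_measurable]) auto
    then have "AE x in distr M ?P (?sh i). psum n x ?k \<noteq> 0"
      by (simp only: incr_distr_shift[OF n])
    then have "AE \<omega> in M. psum n (?sh i \<omega>) ?k \<noteq> 0"
      using S by (subst (asm) AE_distr_iff[OF incr_shift_measurable]) auto
    then show ?thesis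
    proof eventually_elim
      case (elim \<omega>)
      have "psum n (?sh i \<omega>) ?k = psum n (\<lambda>l. incr n \<omega> ((l + i) mod n)) ?k"
        using ij by (intro psum_cong) auto
      also have "\<dots> = psum n (incr n \<omega>) j - psum n (incr n \<omega>) i"
        using ij n by (subst psum_shift) auto
      finally show ?case using elim by auto
    qed
  qed
  have "AE \<omega> in M. \<forall>i\<in>{..<n}. \<forall>j\<in>{..<n}. i < j \<longrightarrow> psum n (incr n \<omega>) i \<noteq> psum n (incr n \<omega>) j"
    using neq by (intro AE_finite_allI) auto
  then show ?thesis
  proof eventually_elim
    case (elim \<omega>)
    then show ?case by (intro linorder_inj_onI) auto
  qed
qed

text \<open>All \<open>n\<close> rotations give the same integral, so the integral is an average
  over rotations. Almost surely there are no ties, and then the integrand summed over rotations is a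
  constant.\<close>

lemma integral_above:
  fixes F :: "real \<Rightarrow> 'b::{banach, second_countable_topology}"
  assumes n: "n > 0" and [measurable]: "F \<in> borel_measurable borel" and bd: "\<And>x. norm (F x) \<le> K"
  shows "(\<integral>\<omega>. F (count_above n (incr n \<omega>)) \<partial>M) = (1 / n) *\<^sub>R (\<Sum>k<n. F (real k))"
proof -
  let ?P = "PiM {..<n} (\<lambda>_. borel) :: (nat \<Rightarrow> real) measure"
  let ?sh = "\<lambda>j \<omega>. \<lambda>l\<in>{..<n}. incr n \<omega> ((l + j) mod n)"
  note [measurable] = measurable_above incr_shift_measurable
  have same: "(\<integral>\<omega>. F (count_above n (?sh j \<omega>)) \<partial>M) = (\<integral>\<omega>. F (count_above n (incr n \<omega>)) \<partial>M)" for j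
  proof -
    have "(\<integral>\<omega>. F (count_above n (?sh j \<omega>)) \<partial>M) = (\<integral>x. F (count_above n x) \<partial>distr M ?P (?sh j))"
      by (subst integral_distr[OF incr_shift_measurable]) auto
    also have "\<dots> = (\<integral>x. F (count_above n x) \<partial>distr M ?P (?sh 0))"
      by (simp only: incr_distr_shift[OF n])
    also have "\<dots> = (\<integral>\<omega>. F (count_above n (?sh 0 \<omega>)) \<partial>M)"
      by (subst integral_distr[OF incr_shift_measurable]) auto
    also have "\<dots> = (\<integral>\<omega>. F (count_above n (incr n \<omega>)) \<partial>M)"
      by (intro Bochner_Integration.integral_cong refl arg_cong[where f=F] above_cong) auto
    finally show ?thesis .
  qed
  have int: "integrable M (\<lambda>\<omega>. F (count_above n (?sh j \<omega>)))" for j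
    using bd by (intro integrable_const_bound[where B=K]) auto
  have "real n *\<^sub>R (\<integral>\<omega>. F (count_above n (incr n \<omega>)) \<partial>M) = (\<Sum>j<n. \<integral>\<omega>. F (count_above n (?sh j \<omega>)) \<partial>M)"
    unfolding same by (simp add: sum_constant_scaleR)
  also have "\<dots> = (\<integral>\<omega>. (\<Sum>j<n. F (count_above n (?sh j \<omega>))) \<partial>M)"
    using int by (subst Bochner_Integration.integral_sum) auto
  also have "\<dots> = (\<integral>\<omega>. (\<Sum>k<n. F (real k)) \<partial>M)"
  proof (rule integral_cong_AE)
    show "AE \<omega> in M. (\<Sum>j<n. F (count_above n (?sh j \<omega>))) = (\<Sum>k<n. F (real k))"
      using AE_psum_inj[OF n]
    proof eventually_elim
      case (elim \<omega>)
      have "(\<Sum>j<n. F (count_above n (?sh j \<omega>))) = (\<Sum>j<n. F (count_above n (\<lambda>l. incr n \<omega> ((l + j) mod n))))"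
        by (intro sum.cong refl arg_cong[where f=F] above_cong) auto
      then show ?case using sum_above_shifts[OF n elim] by simp
    qed
  qed measurable
  also have "\<dots> = (\<Sum>k<n. F (real k))" by (simp add: prob_space)
  finally have "(1 / n) *\<^sub>R (real n *\<^sub>R (\<integral>\<omega>. F (count_above n (incr n \<omega>)) \<partial>M)) = (1 / n) *\<^sub>R (\<Sum>k<n. F (real k))"
    by simp
  with n show ?thesis by simp
qed

section \<open>Passage to the limit\<close>

text \<open>The truncation at 0 makes the bridge jointly measurable on the whole line: nothing is
  known about X at negative times.\<close>

definition bridge :: "real \<Rightarrow> 'a \<Rightarrow> real" where
  "bridge t \<omega> = X (max 0 t) \<omega> - t * X 1 \<omega>"

text \<open>The right grid neighbours approach \<open>t\<close> strictly from above, so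
  right-continuity of the path is enough.\<close>

lemma bridge_grid_tendsto:
  assumes \<omega>: "\<omega> \<in> space M" and t: "t \<ge> 0"
  shows "(\<lambda>n. bridge (real (Suc (nat \<lfloor>real (Suc n) * t\<rfloor>)) / real (Suc n)) \<omega>) \<longlonglongrightarrow> bridge t \<omega>"
proof -
  let ?r = "\<lambda>n. real (Suc (nat \<lfloor>real (Suc n) * t\<rfloor>)) / real (Suc n)"
  have r: "filterlim ?r (at_right t) sequentially" by (rule floor_grid_tendsto(2)[OF t])
  have "((\<lambda>t. X t \<omega>) \<longlongrightarrow> X t \<omega>) (at_right t)"
    using X_cadlag[OF \<omega>] t by (auto simp: cadlag_on_nonneg_def continuous_within)
  then have "(\<lambda>n. X (?r n) \<omega>) \<longlonglongrightarrow> X t \<omega>"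
    using r by (rule filterlim_compose)
  moreover have "?r \<longlonglongrightarrow> t" using r by (simp add: filterlim_at)
  ultimately have "(\<lambda>n. X (?r n) \<omega> - ?r n * X 1 \<omega>) \<longlonglongrightarrow> X t \<omega> - t * X 1 \<omega>"
    by (intro tendsto_intros)
  then show ?thesis using t by (simp add: bridge_def max_def)
qed

text \<open>The bridge is a pointwise limit of versions sampled at grid times. Each of these
  involves only countably many variables \<open>X (k / n)\<close>, selected by a measurable
  index.\<close>

lemma bridge_measurable: "case_prod bridge \<in> borel_measurable (borel \<Otimes>\<^sub>M M)"
proof -
  define q where "q t = max 0 (t::real)" for t
  have [measurable]: "q \<in> borel_measurable borel" unfolding q_def by measurable
  have [measurable]: "X (real k / real n) \<in> borel_measurable M" for k n :: nat
    by (rule X_measurable) simp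
  have [measurable]: "X 1 \<in> borel_measurable M" by (rule X_measurable) simp
  \<comment> \<open>The approximation holds at nonnegative times only, so time is first clamped by
    \<open>q\<close>.\<close>
  have "(\<lambda>p. bridge (q (fst p)) (snd p)) \<in> borel_measurable (borel \<Otimes>\<^sub>M M)"
  proof (rule borel_measurable_LIMSEQ_metric)
    fix n
    have "(\<lambda>p. X (real (Suc (nat \<lfloor>real (Suc n) * q (fst p)\<rfloor>)) / real (Suc n)) (snd p)) \<in> borel_measurable (borel \<Otimes>\<^sub>M M)"
      by (rule measurable_compose_countable[where f="\<lambda>k p. X (real (Suc k) / real (Suc n)) (snd p)" and
            g="\<lambda>p. nat \<lfloor>real (Suc n) * q (fst p)\<rfloor>"]) measurable
    then show "(\<lambda>p. bridge (real (Suc (nat \<lfloor>real (Suc n) * q (fst p)\<rfloor>)) / real (Suc n)) (snd p))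
        \<in> borel_measurable (borel \<Otimes>\<^sub>M M)"
      unfolding bridge_def by (simp add: max_def) measurable
  qed (rule bridge_grid_tendsto, auto simp: space_pair_measure q_def)
  \<comment> \<open>Clamping leaves the \<open>X\<close> term of \<open>bridge\<close> unchanged;
    only the linear drift has to be corrected from \<open>q t\<close> back to
    \<open>t\<close>.\<close>
  then have "(\<lambda>p. bridge (q (fst p)) (snd p) + q (fst p) * X 1 (snd p) - fst p * X 1 (snd p))
      \<in> borel_measurable (borel \<Otimes>\<^sub>M M)" by measurable
  then show ?thesis by (simp add: bridge_def q_def split_beta')
qed

text \<open>Times range over the whole line because \<open>unif\<close> ignores those outside the
  open unit interval; this makes \<open>occ\<close> the measure of a section of a jointly measurable
  set.\<close>

definition occ :: "'a \<Rightarrow> real" where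
  "occ \<omega> = measure unif {t. bridge t \<omega> > 0}"

lemma bridge_section_measurable: "\<omega> \<in> space M \<Longrightarrow> (\<lambda>t. bridge t \<omega>) \<in> borel_measurable borel"
  using measurable_compose[OF measurable_Pair2' bridge_measurable] by simp

lemma occ_eq:
  assumes \<omega>: "\<omega> \<in> space M"
  shows "measure lborel {t\<in>{0..1}. X t \<omega> - t * X 1 \<omega> > 0} = occ \<omega>"
proof -
  have [measurable]: "(\<lambda>t. bridge t \<omega>) \<in> borel_measurable borel"
    using \<omega> by (rule bridge_section_measurable)
  have e: "{t\<in>{0..1}. X t \<omega> - t * X 1 \<omega> > 0} = {t\<in>{0..1}. bridge t \<omega> > 0}"
    by (auto simp: bridge_def max_def)
  have "measure lborel {t\<in>{0..1}. bridge t \<omega> > 0} = measure lborel ({0<..<1} \<inter> {t. bridge t \<omega> > 0})"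
    using AE_lborel_singleton[of "0::real"] AE_lborel_singleton[of "1::real"]
    by (intro measure_eq_AE) auto
  then show ?thesis unfolding e occ_def by (subst measure_uniform_measure) auto
qed

lemma occ_measurable: "occ \<in> borel_measurable M"
proof -
  interpret U: prob_space unif by (rule prob_space_unif)
  note [measurable] = bridge_measurable
  have Q: "{p \<in> space (M \<Otimes>\<^sub>M unif). bridge (snd p) (fst p) > 0} \<in> sets (M \<Otimes>\<^sub>M unif)"
    by measurable
  have "(\<lambda>\<omega>. measure unif (Pair \<omega> -` {p \<in> space (M \<Otimes>\<^sub>M unif). bridge (snd p) (fst p) > 0}))
      \<in> borel_measurable M"
    using U.measurable_emeasure_Pair[OF Q] unfolding measure_def by measurable
  then show ?thesis
    by (subst measurable_cong) (auto simp: occ_def space_pair_measure vimage_def)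
qed

text \<open>Fubini turns "nonzero almost surely at each time" into "almost surely nonzero at almost
  every time". At such times the positivity indicator along right grid neighbours converges, and
  dominated convergence in \<open>t\<close> finishes.\<close>

lemma AE_occ_tendsto:
  "AE \<omega> in M. (\<lambda>n. count_above (Suc n) (incr (Suc n) \<omega>) / Suc n) \<longlonglongrightarrow> occ \<omega>"
proof -
  interpret U: prob_space unif by (rule prob_space_unif)
  interpret P: pair_sigma_finite M unif ..
  note [measurable] = bridge_measurable
  have "AE t in unif. AE \<omega> in M. bridge t \<omega> \<noteq> 0"
    using AE_unif
  proof eventually_elim
    case (elim t)
    then show ?case using AE_bridge_neq_0[of t] by (simp add: bridge_def)
  qed
  moreover have "{p \<in> space (M \<Otimes>\<^sub>M unif). bridge (snd p) (fst p) \<noteq> 0} \<in> sets (M \<Otimes>\<^sub>M unif)"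
    by measurable
  ultimately have "AE \<omega> in M. AE t in unif. bridge t \<omega> \<noteq> 0"
    using P.AE_commute[of "\<lambda>\<omega> t. bridge t \<omega> \<noteq> 0"] by simp
  then show ?thesis
    using AE_space
  proof eventually_elim
    case (elim \<omega>)
    have [measurable]: "(\<lambda>t. bridge t \<omega>) \<in> borel_measurable borel"
      using elim(2) by (rule bridge_section_measurable)
    let ?h = "\<lambda>t. indicator {t. bridge t \<omega> > 0} t :: real"
    have bridge01: "bridge 0 \<omega> = 0" "bridge 1 \<omega> = 0"
      using X_0[OF elim(2)] by (auto simp: bridge_def)
    have avg: "count_above (Suc n) (incr (Suc n) \<omega>) / Suc n
        = (\<integral>t. ?h (real (Suc (nat \<lfloor>real (Suc n) * t\<rfloor>)) / real (Suc n)) \<partial>unif)" for n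
    proof -
      let ?g = "\<lambda>i. ?h (real i / real (Suc n))"
      have "count_above (Suc n) (incr (Suc n) \<omega>) = (\<Sum>i<Suc n. ?g i)"
        unfolding count_above_def using elim(2)
        by (intro sum.cong refl) (auto simp: psum_incr bridge_def indicator_def max_def simp del: of_nat_Suc)
      \<comment> \<open>\<open>count_above\<close> samples at \<open>0, ..., n\<close> over
        \<open>Suc n\<close>, while right grid neighbours run over \<open>1, ..., Suc n\<close>. The
        bridge vanishes at times 0 and 1, so exchanging the two end terms changes nothing.\<close>
      also have "\<dots> = (\<Sum>i<Suc n. ?g (Suc i))"
        using sum.lessThan_Suc_shift[of ?g "Suc n"] sum.lessThan_Suc[of ?g "Suc n"] bridge01
        by (simp del: sum.lessThan_Suc of_nat_Suc)
      finally have "count_above (Suc n) (incr (Suc n) \<omega>) / Suc n = (1 / Suc n) *\<^sub>R (\<Sum>i<Suc n. ?g (Suc i))"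
        by simp
      also have "\<dots> = (\<integral>t. ?g (Suc (nat \<lfloor>real (Suc n) * t\<rfloor>)) \<partial>unif)"
        by (rule integral_floor_unif[symmetric]) simp
      finally show ?thesis .
    qed
    have "(\<lambda>n. \<integral>t. ?h (real (Suc (nat \<lfloor>real (Suc n) * t\<rfloor>)) / real (Suc n)) \<partial>unif) \<longlonglongrightarrow> (\<integral>t. ?h t \<partial>unif)"
    proof (rule integral_dominated_convergence[where w="\<lambda>_. 1"])
      show "AE t in unif. (\<lambda>n. ?h (real (Suc (nat \<lfloor>real (Suc n) * t\<rfloor>)) / real (Suc n))) \<longlonglongrightarrow> ?h t"
        using elim(1) AE_unif
      proof eventually_elim
        fix t assume t: "bridge t \<omega> \<noteq> 0" "t \<in> {0<..<1}"
        let ?b = "\<lambda>n. bridge (real (Suc (nat \<lfloor>real (Suc n) * t\<rfloor>)) / real (Suc n)) \<omega>"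
        have lim: "?b \<longlonglongrightarrow> bridge t \<omega>"
          using bridge_grid_tendsto[OF elim(2), of t] t by simp
        \<comment> \<open>The limit \<open>bridge t \<omega>\<close> is nonzero, so the sampled
          values eventually share its sign and the indicator becomes constant.\<close>
        have "eventually (\<lambda>n. ?h (real (Suc (nat \<lfloor>real (Suc n) * t\<rfloor>)) / real (Suc n)) = ?h t) sequentially"
        proof (cases "bridge t \<omega> > 0")
          case True
          from order_tendstoD(1)[OF lim this] show ?thesis
            by eventually_elim (use True in \<open>simp add: indicator_def\<close>)
        next
          case False
          with t have neg: "bridge t \<omega> < 0" by simp
          from order_tendstoD(2)[OF lim this] show ?thesis
            by eventually_elim (use neg in \<open>simp add: indicator_def\<close>)
        qed
        then show "(\<lambda>n. ?h (real (Suc (nat \<lfloor>real (Suc n) * t\<rfloor>)) / real (Suc n))) \<longlonglongrightarrow> ?h t"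
          by (rule tendsto_eventually)
      qed
    qed (auto simp: indicator_def)
    then show ?case unfolding avg by (simp add: occ_def)
  qed
qed

text \<open>The characteristic function of the discrete occupation time is exactly a Riemann sum of
  \<open>iexp (\<xi> * x)\<close>. It converges both to that of \<open>occ\<close> and to that of
  \<open>unif\<close>, and equal characteristic functions determine the law.\<close>

lemma distr_occ: "distr M borel occ = unif"
proof (rule Levy_uniqueness)
  show "real_distribution (distr M borel occ)" using occ_measurable by simp
  show "real_distribution unif"
    using prob_space_unif by (simp add: real_distribution_def real_distribution_axioms_def)
  show "char (distr M borel occ) = char unif"
  proof
    fix \<xi> :: real
    define F where "F x = iexp (\<xi> * x)" for x
    have F: "continuous_on UNIV F" unfolding F_def by (intro continuous_intros)
    have bd: "norm (F x) \<le> 1" for x unfolding F_def by simp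
    have [measurable]: "F \<in> borel_measurable borel" by (rule borel_measurable_continuous_onI[OF F])
    have [measurable]: "(\<lambda>\<omega>. count_above n (incr n \<omega>)) \<in> borel_measurable M" for n
    proof -
      \<comment> \<open>Points of the product space are extensional, so measurability is obtained
        for the restricted increments, on which \<open>count_above\<close> takes the same
        value.\<close>
      have "(\<lambda>\<omega>. count_above n (\<lambda>l\<in>{..<n}. incr n \<omega> l)) \<in> borel_measurable M"
        by (rule measurable_compose[OF _ measurable_above]) (intro measurable_restrict incr_measurable)
      also have "(\<lambda>\<omega>. count_above n (\<lambda>l\<in>{..<n}. incr n \<omega> l)) = (\<lambda>\<omega>. count_above n (incr n \<omega>))"
        by (intro ext above_cong) auto
      finally show ?thesis .
    qed
    note [measurable] = occ_measurable
    have "(\<lambda>n. \<integral>\<omega>. F (count_above (Suc n) (incr (Suc n) \<omega>) / Suc n) \<partial>M) \<longlonglongrightarrow> (\<integral>\<omega>. F (occ \<omega>) \<partial>M)"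
    proof (rule integral_dominated_convergence[where w="\<lambda>_. 1"])
      show "AE \<omega> in M. (\<lambda>n. F (count_above (Suc n) (incr (Suc n) \<omega>) / Suc n)) \<longlonglongrightarrow> F (occ \<omega>)"
        using AE_occ_tendsto
      proof eventually_elim
        case (elim \<omega>)
        then show ?case
          using F by (intro isCont_tendsto_compose[of _ F]) (auto simp: continuous_on_eq_continuous_at)
      qed
    qed (use bd in auto)
    moreover have "(\<integral>\<omega>. F (count_above (Suc n) (incr (Suc n) \<omega>) / Suc n) \<partial>M)
        = (1 / Suc n) *\<^sub>R (\<Sum>k<Suc n. F (real k / Suc n))" for n
      by (rule integral_above[where F="\<lambda>x. F (x / Suc n)" and K=1]) (use bd in auto)
    ultimately have "(\<integral>\<omega>. F (occ \<omega>) \<partial>M) = (\<integral>t. F t \<partial>unif)"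
      using riemann_sum_tendsto_unif[OF F bd] by (auto intro: LIMSEQ_unique)
    then show "char (distr M borel occ) \<xi> = char unif \<xi>"
      unfolding char_def by (subst integral_distr) (auto simp: F_def)
  qed
qed

end

theorem mainTheorem14:
  fixes M :: "'a measure" and X :: "real \<Rightarrow> 'a \<Rightarrow> real"
  assumes "levy_process M X"
    and "\<forall>x. measure M {\<omega>\<in>space M. X 1 \<omega> = x} = 0"
  defines "A \<equiv> (\<lambda>\<omega>. measure lborel {t\<in>{0..1}. X t \<omega> - t * X 1 \<omega> > 0})"
  shows "A \<in> borel_measurable M \<and>
         distr M borel A = uniform_measure lborel {0<..<1}"
proof -
  interpret atomless_levy M X
    using assms(1,2) by unfold_locales auto
  have A: "A \<omega> = occ \<omega>" if "\<omega> \<in> space M" for \<omega>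
    unfolding A_def by (rule occ_eq[OF that])
  have "A \<in> borel_measurable M"
    using occ_measurable by (subst measurable_cong[OF A])
  moreover have "distr M borel A = distr M borel occ"
    by (rule distr_cong) (auto simp: A)
  ultimately show ?thesis using distr_occ by simp
qed

end
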